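(* Let $G=(X\cup Y,E)$ be an arbitrary bipartite graph and let $\mathcal{I}=\{X\}$ be the partition of $X$ consisting of the single subset $X$. Let $H\subseteq\mathbb{R}^{X\cup Y\cup E}$ be the polytope of all $(x,y,z)$ satisfying the following inequalities: $$0\le y_j\le 1\quad\forall j\in Y,\qquad x_i\ge 0\quad\forall i\in X,\qquad \sum_{i\in I}x_i\le 1\quad\forall I\in\mathcal{I},$$ $$z_{ij}\ge 0\quad\forall\{i,j\}\in E,\qquad x_i-z_{ij}\ge 0\quad\forall \{i,j\}\in E,$$ $$y_j-\sum_{i\in N(j)\cap I}z_{ij}\ge 0\quad\forall I\in\mathcal{I},\,j\in Y,\qquad y_j+\sum_{i\in N(j)\cap I}(x_i-z_{ij})\le 1\quad\forall I\in\mathcal{I},\,j\in Y.$$ Then $H=P(G,\mathcal{I})$.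
   Context: $G=(X\cup Y,E)$ is a finite bipartite graph with disjoint node sets $X,Y$ ($X$ non-empty); every edge $\{i,j\}\in E$ has $i\in X$, $j\in Y$. $N(v)$ is the set of neighbours of node $v$. Vectors in $\mathbb{R}^{X\cup Y\cup E}$ are written $(x,y,z)$ with $x\in\mathbb{R}^X$, $y\in\mathbb{R}^Y$, $z\in\mathbb{R}^E$. For a partition $\mathcal{I}$ of $X$, put $X^{\mathcal{I}}=\{x\in\{0,1\}^X : \sum_{i\in I}x_i\le 1\ \forall I\in\mathcal{I}\}$ and $$P(G,\mathcal{I})=\operatorname{conv}\{(x,y,z)\in\{0,1\}^{X\cup Y\cup E} : x_iy_j=z_{ij}\ \forall\{i,j\}\in E,\ x\in X^{\mathcal{I}}\}.$$ *)

theory Defs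
  imports "HOL-Analysis.Analysis"
begin

text \<open>
  Nodes are drawn from a finite type; \<open>X\<close> and \<open>Y\<close> need not exhaust it, and \<open>Y\<close> or the edge
  set may be empty. Edges are unordered pairs, i.e. two-element sets of nodes.
\<close>

definition bipartite_graph :: "'v set \<Rightarrow> 'v set \<Rightarrow> 'v set set \<Rightarrow> bool" where
  "bipartite_graph X Y E \<longleftrightarrow>
     finite X \<and> finite Y \<and> X \<noteq> {} \<and> X \<inter> Y = {} \<and> (\<forall>e\<in>E. \<exists>i\<in>X. \<exists>j\<in>Y. e = {i, j})"

definition neighbours :: "'v set set \<Rightarrow> 'v \<Rightarrow> 'v set" where
  "neighbours E v = {u. {u, v} \<in> E}"

text \<open>
  \<open>coord_space S\<close> is the space of real vectors indexed by \<open>S\<close>, realised as the coordinate subspace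
  of vectors vanishing outside \<open>S\<close>. A vector indexed by \<open>X \<union> Y \<union> E\<close> is a triple \<open>(x, y, z)\<close>,
  and \<open>z $ {i, j}\<close> is the coordinate of the edge \<open>{i, j}\<close>.
\<close>

definition coord_space :: "'k::finite set \<Rightarrow> (real ^ 'k) set" where
  "coord_space S = {v. \<forall>k. k \<notin> S \<longrightarrow> v $ k = 0}"

definition binary_vectors :: "'k::finite set \<Rightarrow> (real ^ 'k) set" where
  "binary_vectors S = {v \<in> coord_space S. \<forall>k\<in>S. v $ k \<in> {0, 1}}"

definition multiple_choice :: "'v::finite set \<Rightarrow> 'v set set \<Rightarrow> (real ^ 'v) set" where
  "multiple_choice X \<I> = {x \<in> binary_vectors X. \<forall>I\<in>\<I>. (\<Sum>i\<in>I. x $ i) \<le> 1}"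

definition bipartite_boolean_quadric_polytope ::
  "'v::finite set \<Rightarrow> 'v set \<Rightarrow> 'v set set \<Rightarrow> 'v set set \<Rightarrow>
     ((real ^ 'v) \<times> (real ^ 'v) \<times> (real ^ ('v set))) set" where
  "bipartite_boolean_quadric_polytope X Y E \<I> = convex hull
     {(x, y, z). x \<in> binary_vectors X \<and> y \<in> binary_vectors Y \<and> z \<in> binary_vectors E \<and>
        (\<forall>i\<in>X. \<forall>j\<in>Y. {i, j} \<in> E \<longrightarrow> x $ i * y $ j = z $ {i, j}) \<and>
        x \<in> multiple_choice X \<I>}"

definition relaxation ::
  "'v::finite set \<Rightarrow> 'v set \<Rightarrow> 'v set set \<Rightarrow> 'v set set \<Rightarrow>
     ((real ^ 'v) \<times> (real ^ 'v) \<times> (real ^ ('v set))) set" where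
  "relaxation X Y E \<I> =
     {(x, y, z). x \<in> coord_space X \<and> y \<in> coord_space Y \<and> z \<in> coord_space E \<and>
        (\<forall>j\<in>Y. 0 \<le> y $ j \<and> y $ j \<le> 1) \<and>
        (\<forall>i\<in>X. x $ i \<ge> 0) \<and>
        (\<forall>I\<in>\<I>. (\<Sum>i\<in>I. x $ i) \<le> 1) \<and>
        (\<forall>i\<in>X. \<forall>j\<in>Y. {i, j} \<in> E \<longrightarrow> z $ {i, j} \<ge> 0) \<and>
        (\<forall>i\<in>X. \<forall>j\<in>Y. {i, j} \<in> E \<longrightarrow> x $ i - z $ {i, j} \<ge> 0) \<and>
        (\<forall>I\<in>\<I>. \<forall>j\<in>Y. y $ j - (\<Sum>i \<in> neighbours E j \<inter> I. z $ {i, j}) \<ge> 0) \<and>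
        (\<forall>I\<in>\<I>. \<forall>j\<in>Y. y $ j + (\<Sum>i \<in> neighbours E j \<inter> I. x $ i - z $ {i, j}) \<le> 1)}"

end

(* Under the single constraint sum x <= 1, a point (x, y, z) of H is read as a probability
   distribution. Choose x to be the unit vector e_i with probability x_i and 0 with probability
   1 - sum x; conditionally on e_i let y_j = 1 with probability z_ij / x_i when {i, j} is an edge,
   and otherwise with a probability theta_j independent of i, so chosen that y_j comes out as
   the right mean. The last two families of inequalities say exactly that 0 <= theta_j <= 1.
   With x fixed, z is a linear function of y, so that each conditional mean lies in the
   polytope because the unit cube is the convex hull of its vertices. *)
theory Submission
  imports Defs
begin

text \<open>Cutting off the coordinates outside \<open>S\<close> lets \<open>y\<close> range over
  the unit cube of the whole space, while its image stays in \<open>coord_space S\<close>.\<close>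

definition restrict_vec :: "'k::finite set \<Rightarrow> real ^ 'k \<Rightarrow> real ^ 'k" where
  "restrict_vec S y = (\<chi> k. if k \<in> S then y $ k else 0)"

text \<open>On an edge of a bipartite graph both sums have a single term.\<close>

definition edge_products ::
  "'v::finite set \<Rightarrow> 'v set \<Rightarrow> 'v set set \<Rightarrow> real ^ 'v \<Rightarrow> real ^ 'v \<Rightarrow> real ^ ('v set)" where
  "edge_products X Y E x y =
     (\<chi> e. if e \<in> E then (\<Sum>i\<in>e \<inter> X. x $ i) * (\<Sum>j\<in>e \<inter> Y. y $ j) else 0)"

lemma edge_inter:
  assumes "X \<inter> Y = {}" "i \<in> X" "j \<in> Y"
  shows "{i, j} \<inter> X = {i}" "{i, j} \<inter> Y = {j}"
  using assms by auto

lemma edge_products_edge: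
  assumes "X \<inter> Y = {}" "i \<in> X" "j \<in> Y" "{i, j} \<in> E"
  shows "edge_products X Y E x y $ {i, j} = x $ i * y $ j"
  using assms(4) edge_inter[OF assms(1-3)] by (simp add: edge_products_def)

lemma linear_restrict_vec: "linear (restrict_vec S)"
  by (rule linearI) (auto simp: restrict_vec_def vec_eq_iff)

lemma linear_edge_products: "linear (edge_products X Y E x)"
  by (rule linearI)
    (auto simp: edge_products_def vec_eq_iff sum.distrib distrib_left sum_distrib_left[symmetric])

text \<open>Every constraint is a linear equation or a weak linear inequality, so it survives convex
  combinations. The work lies in regrouping the sums until each one is visibly the same combination
  of its values at \<open>p\<close> and \<open>q\<close>.\<close>

lemma convex_relaxation: "convex (relaxation X Y E \<I>)"
proof (rule convexI)
  fix p q :: "(real ^ 'a) \<times> (real ^ 'a) \<times> (real ^ ('a set))" and u v :: real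
  assume "p \<in> relaxation X Y E \<I>" and "q \<in> relaxation X Y E \<I>"
    and u: "0 \<le> u" and v: "0 \<le> v" and uv: "u + v = 1"
  moreover obtain x y z x' y' z' where pq: "p = (x, y, z)" "q = (x', y', z')"
    by (metis prod_cases3)
  ultimately have p: "(x, y, z) \<in> relaxation X Y E \<I>" and q: "(x', y', z') \<in> relaxation X Y E \<I>"
    by auto
  have nonneg: "0 \<le> u * a + v * b" if "0 \<le> a" "0 \<le> b" for a b
    using that u v by simp
  have le1: "u * a + v * b \<le> 1" if "a \<le> 1" "b \<le> 1" for a b
    using convex_bound_le[OF that u v uv] .
  have "(\<Sum>i\<in>I. u * x $ i + v * x' $ i) \<le> 1" if "I \<in> \<I>" for I
  proof -
    have "(\<Sum>i\<in>I. u * x $ i + v * x' $ i) = u * (\<Sum>i\<in>I. x $ i) + v * (\<Sum>i\<in>I. x' $ i)"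
      by (simp add: sum.distrib sum_distrib_left)
    then show ?thesis using that p q le1 by (simp add: relaxation_def)
  qed
  moreover have "0 \<le> (u * x $ i + v * x' $ i) - (u * z $ {i, j} + v * z' $ {i, j})"
    if "i \<in> X" "j \<in> Y" "{i, j} \<in> E" for i j
    using nonneg[of "x $ i - z $ {i, j}" "x' $ i - z' $ {i, j}"] that p q
    by (simp add: relaxation_def algebra_simps)
  moreover have "0 \<le> (u * y $ j + v * y' $ j)
      - (\<Sum>i \<in> neighbours E j \<inter> I. u * z $ {i, j} + v * z' $ {i, j})"
    if "I \<in> \<I>" "j \<in> Y" for I j
  proof -
    let ?N = "neighbours E j \<inter> I"
    have "(u * y $ j + v * y' $ j) - (\<Sum>i \<in> ?N. u * z $ {i, j} + v * z' $ {i, j}) =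
        u * (y $ j - (\<Sum>i \<in> ?N. z $ {i, j})) + v * (y' $ j - (\<Sum>i \<in> ?N. z' $ {i, j}))"
      by (simp add: sum.distrib sum_distrib_left algebra_simps)
    also have "\<dots> \<ge> 0"
      using that p q by (intro nonneg) (auto simp: relaxation_def)
    finally show ?thesis .
  qed
  moreover have "(u * y $ j + v * y' $ j) + (\<Sum>i \<in> neighbours E j \<inter> I.
      (u * x $ i + v * x' $ i) - (u * z $ {i, j} + v * z' $ {i, j})) \<le> 1"
    if "I \<in> \<I>" "j \<in> Y" for I j
  proof -
    let ?N = "neighbours E j \<inter> I"
    have "(u * y $ j + v * y' $ j)
        + (\<Sum>i \<in> ?N. (u * x $ i + v * x' $ i) - (u * z $ {i, j} + v * z' $ {i, j})) =
        u * (y $ j + (\<Sum>i \<in> ?N. x $ i - z $ {i, j}))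
        + v * (y' $ j + (\<Sum>i \<in> ?N. x' $ i - z' $ {i, j}))"
      by (simp add: sum.distrib sum_subtractf sum_distrib_left algebra_simps)
    also have "\<dots> \<le> 1"
      using that p q by (intro le1) (auto simp: relaxation_def)
    finally show ?thesis .
  qed
  ultimately show "u *\<^sub>R p + v *\<^sub>R q \<in> relaxation X Y E \<I>"
    using p q nonneg le1 by (simp add: pq relaxation_def coord_space_def)
qed

lemma binary_vectors_cases:
  assumes "v \<in> binary_vectors S"
  shows "v $ k = 0 \<or> v $ k = 1"
  using assms unfolding binary_vectors_def coord_space_def by blast

text \<open>The right-hand side is convex, so it suffices to check the generating 0/1 points. The
  assumption on \<open>\<I>\<close> places the neighbours of \<open>j\<close> in \<open>I\<close>
  inside \<open>X\<close>, where \<open>z $ {i, j}\<close> is known to be a product.\<close>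

lemma polytope_subset_relaxation:
  assumes "\<And>I. I \<in> \<I> \<Longrightarrow> I \<subseteq> X"
  shows "bipartite_boolean_quadric_polytope X Y E \<I> \<subseteq> relaxation X Y E \<I>"
  unfolding bipartite_boolean_quadric_polytope_def
proof (rule hull_minimal)
  show "convex (relaxation X Y E \<I>)"
    by (rule convex_relaxation)
  show "{(x, y, z). x \<in> binary_vectors X \<and> y \<in> binary_vectors Y \<and> z \<in> binary_vectors E \<and>
      (\<forall>i\<in>X. \<forall>j\<in>Y. {i, j} \<in> E \<longrightarrow> x $ i * y $ j = z $ {i, j}) \<and>
      x \<in> multiple_choice X \<I>} \<subseteq> relaxation X Y E \<I>"
  proof clarify
    fix x y :: "real ^ 'a" and z :: "real ^ ('a set)"
    assume x: "x \<in> binary_vectors X" and y: "y \<in> binary_vectors Y" and z: "z \<in> binary_vectors E"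
      and xyz: "\<forall>i\<in>X. \<forall>j\<in>Y. {i, j} \<in> E \<longrightarrow> x $ i * y $ j = z $ {i, j}"
      and mc: "x \<in> multiple_choice X \<I>"
    have x01: "x $ i = 0 \<or> x $ i = 1" and y01: "y $ i = 0 \<or> y $ i = 1" for i
      using binary_vectors_cases x y by blast+
    have x0: "0 \<le> x $ i" and y0: "0 \<le> y $ i" and y1: "y $ i \<le> 1" for i
      using x01[of i] y01[of i] by auto
    have xz: "0 \<le> z $ {i, j}" "z $ {i, j} \<le> x $ i" if "i \<in> X" "j \<in> Y" "{i, j} \<in> E" for i j
      using xyz[rule_format, OF that] x01[of i] y01[of j] by auto
    have "(\<Sum>i \<in> neighbours E j \<inter> I. z $ {i, j}) \<le> y $ j \<and>
        y $ j + (\<Sum>i \<in> neighbours E j \<inter> I. x $ i - z $ {i, j}) \<le> 1"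
      if I: "I \<in> \<I>" and j: "j \<in> Y" for I j
    proof -
      let ?N = "neighbours E j \<inter> I"
      have zN: "z $ {i, j} = x $ i * y $ j" if "i \<in> ?N" for i
        using that xyz assms[OF I] j by (auto simp: neighbours_def)
      have "(\<Sum>i\<in>?N. x $ i) \<le> (\<Sum>i\<in>I. x $ i)"
        by (rule sum_mono2) (auto simp: x0)
      also have "\<dots> \<le> 1"
        using mc I by (auto simp: multiple_choice_def)
      \<comment> \<open>If \<open>y $ j = 1\<close>, the first inequality is this bound and all
        differences \<open>x $ i - z $ {i, j}\<close> vanish. If \<open>y $ j = 0\<close>, all
        \<open>z $ {i, j}\<close> vanish and the second inequality is this bound.\<close>
      finally show ?thesis
        using y01[of j] by (auto simp: zN)
    qed
    then show "(x, y, z) \<in> relaxation X Y E \<I>"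
      using x y z x0 y0 y1 xz mc
      by (auto simp: relaxation_def binary_vectors_def multiple_choice_def)
  qed
qed

text \<open>The polytope is pulled back along the map sending \<open>y\<close> to the lifted point,
  which is affine for fixed \<open>x\<close>. The preimage \<open>?D\<close> is convex and contains
  all 0/1 vectors, hence the whole cube.\<close>

lemma polytope_fibre:
  assumes XY: "X \<inter> Y = {}" and edges: "\<And>e. e \<in> E \<Longrightarrow> \<exists>i\<in>X. \<exists>j\<in>Y. e = {i, j}"
    and x: "x \<in> multiple_choice X \<I>"
    and y: "\<And>j. 0 \<le> y $ j" "\<And>j. y $ j \<le> 1"
  shows "(x, restrict_vec Y y, edge_products X Y E x y) \<in> bipartite_boolean_quadric_polytope X Y E \<I>"
proof -
  let ?C = "bipartite_boolean_quadric_polytope X Y E \<I>"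
  let ?D = "{y. (x, restrict_vec Y y, edge_products X Y E x y) \<in> ?C}"
  have "convex ?D"
  proof (rule convexI)
    fix y y' and u v :: real
    assume yy': "y \<in> ?D" "y' \<in> ?D" and uv: "0 \<le> u" "0 \<le> v" "u + v = 1"
    have "convex ?C"
      by (simp add: bipartite_boolean_quadric_polytope_def)
    then have "u *\<^sub>R (x, restrict_vec Y y, edge_products X Y E x y)
        + v *\<^sub>R (x, restrict_vec Y y', edge_products X Y E x y') \<in> ?C"
      using yy' uv by (intro convexD) auto
    \<comment> \<open>The first component is constant in \<open>y\<close>; it is preserved because
      the weights add up to 1.\<close>
    moreover have "u *\<^sub>R x + v *\<^sub>R x = x"
      by (simp add: scaleR_left_distrib[symmetric] uv(3))
    ultimately show "u *\<^sub>R y + v *\<^sub>R y' \<in> ?D"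
      by (simp add: linear_add[OF linear_restrict_vec] linear_cmul[OF linear_restrict_vec]
          linear_add[OF linear_edge_products] linear_cmul[OF linear_edge_products])
  qed
  moreover have "{y. \<forall>k. y $ k = 0 \<or> y $ k = 1} \<subseteq> ?D"
  proof clarify
    fix y :: "real ^ 'a"
    assume y01: "\<forall>k. y $ k = 0 \<or> y $ k = 1"
    have xb: "x \<in> binary_vectors X"
      using x by (simp add: multiple_choice_def)
    have "edge_products X Y E x y $ e = 0 \<or> edge_products X Y E x y $ e = 1" if "e \<in> E" for e
    proof -
      obtain i j where "i \<in> X" "j \<in> Y" "e = {i, j}"
        using edges \<open>e \<in> E\<close> by blast
      then show ?thesis
        using that y01[rule_format, of j] binary_vectors_cases[OF xb, of i]
        by (auto simp: edge_products_edge[OF XY])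
    qed
    then have "edge_products X Y E x y \<in> binary_vectors E"
      by (auto simp: binary_vectors_def coord_space_def) (simp add: edge_products_def)
    moreover have "restrict_vec Y y \<in> binary_vectors Y"
      using y01 by (auto simp: binary_vectors_def coord_space_def restrict_vec_def)
    ultimately show "(x, restrict_vec Y y, edge_products X Y E x y) \<in> ?C"
      using x xb unfolding bipartite_boolean_quadric_polytope_def
      by (intro hull_inc) (auto simp: edge_products_edge[OF XY], simp add: restrict_vec_def)
  qed
  ultimately have "cbox 0 1 \<subseteq> ?D"
    unfolding Cart_1 unit_interval_convex_hull
    by (intro hull_minimal) (auto simp: Basis_vec_def inner_axis)
  moreover have "y \<in> cbox 0 1"
    using y by (simp add: mem_box_cart)
  ultimately show ?thesis
    by auto
qed

lemma relaxation_subset_polytope: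
  assumes G: "bipartite_graph X Y E"
  shows "relaxation X Y E {X} \<subseteq> bipartite_boolean_quadric_polytope X Y E {X}"
proof clarify
  fix x y :: "real ^ 'a" and z :: "real ^ ('a set)"
  assume H: "(x, y, z) \<in> relaxation X Y E {X}"
  let ?C = "bipartite_boolean_quadric_polytope X Y E {X}"
  have XY: "X \<inter> Y = {}" and edges: "\<And>e. e \<in> E \<Longrightarrow> \<exists>i\<in>X. \<exists>j\<in>Y. e = {i, j}"
    using G by (auto simp: bipartite_graph_def)
  have x: "x \<in> coord_space X" and y: "y \<in> coord_space Y" and z: "z \<in> coord_space E"
    and x0: "\<And>i. i \<in> X \<Longrightarrow> 0 \<le> x $ i" and x1: "(\<Sum>i\<in>X. x $ i) \<le> 1"
    and z0: "\<And>i j. i \<in> X \<Longrightarrow> j \<in> Y \<Longrightarrow> {i, j} \<in> E \<Longrightarrow> 0 \<le> z $ {i, j}"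
    and zx: "\<And>i j. i \<in> X \<Longrightarrow> j \<in> Y \<Longrightarrow> {i, j} \<in> E \<Longrightarrow> z $ {i, j} \<le> x $ i"
    using H by (auto simp: relaxation_def)
  define N where "N j = neighbours E j \<inter> X" for j
  have N: "i \<in> N j \<longleftrightarrow> i \<in> X \<and> {i, j} \<in> E" for i j
    by (auto simp: N_def neighbours_def)
  \<comment> \<open>Here \<open>1 - (\<Sum>i\<in>N j. x $ i)\<close> is the probability that no
    neighbour of \<open>j\<close> is chosen, and
    \<open>y $ j - (\<Sum>i\<in>N j. z $ {i, j})\<close> is the mass of \<open>y_j = 1\<close> left
    for that event. The two bounds place the latter between 0 and the former.\<close>
  have lo: "(\<Sum>i\<in>N j. z $ {i, j}) \<le> y $ j"
    and up: "y $ j - (\<Sum>i\<in>N j. z $ {i, j}) \<le> 1 - (\<Sum>i\<in>N j. x $ i)" if "j \<in> Y" for j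
    using H that by (auto simp: relaxation_def N_def sum_subtractf)
  text \<open>A zero denominator forces a zero numerator, so that the quotients below need no case
    distinction.\<close>
  define \<theta> where "\<theta> j = (y $ j - (\<Sum>i\<in>N j. z $ {i, j})) / (1 - (\<Sum>i\<in>N j. x $ i))" for j
  \<comment> \<open>\<open>None\<close> is the outcome \<open>x = 0\<close> and
    \<open>Some i\<close> the outcome that \<open>x\<close> is the unit vector at \<open>i\<close>;
    \<open>t\<close> gives the probabilities and \<open>e\<close> the outcomes.\<close>
  define t where "t a = (case a of None \<Rightarrow> 1 - (\<Sum>i\<in>X. x $ i) | Some i \<Rightarrow> x $ i)" for a
  define e where "e a = (case a of None \<Rightarrow> 0 | Some i \<Rightarrow> axis i (1::real))" for a :: "'a option"
  \<comment> \<open>Conditional means of \<open>y\<close>. They are set to 0 outside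
    \<open>Y\<close> because \<open>polytope_fibre\<close> asks for bounds in every
    coordinate.\<close>
  define w where "w a = (\<chi> j. case a of
      Some i \<Rightarrow> if j \<in> Y then if {i, j} \<in> E then z $ {i, j} / x $ i else \<theta> j else 0
    | None \<Rightarrow> if j \<in> Y then \<theta> j else 0)" for a
  define A where "A = insert None (Some ` X)"
  define p where "p a = (e a, restrict_vec Y (w a), edge_products X Y E (e a) (w a))" for a
  have sumA: "(\<Sum>a\<in>A. g a) = g None + (\<Sum>i\<in>X. g (Some i))" for g :: "'a option \<Rightarrow> real"
    by (simp add: A_def sum.reindex)
  have \<theta>01: "0 \<le> \<theta> j" "\<theta> j \<le> 1" if "j \<in> Y" for j
    using lo[OF that] up[OF that] by (auto simp: \<theta>_def divide_le_eq_1)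
  have \<theta>: "\<theta> j * (1 - (\<Sum>i\<in>N j. x $ i)) = y $ j - (\<Sum>i\<in>N j. z $ {i, j})" if "j \<in> Y" for j
    using lo[OF that] up[OF that] by (auto simp: \<theta>_def)
  \<comment> \<open>The joint mass of the outcome \<open>Some i\<close> and \<open>y_j = 1\<close>.
    If \<open>x $ i = 0\<close>, then \<open>z0\<close> and \<open>zx\<close> squeeze
    \<open>z $ {i, j}\<close> to 0 on an edge.\<close>
  have xw: "x $ i * w (Some i) $ j = (if i \<in> N j then z $ {i, j} else x $ i * \<theta> j)"
    if "i \<in> X" "j \<in> Y" for i j
    using that z0[of i j] zx[of i j] by (auto simp: w_def N)
  have "(\<Sum>a\<in>A. t a *\<^sub>R p a) \<in> ?C"
  proof (rule convex_sum)
    show "finite A" "convex ?C"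
      by (simp_all add: A_def bipartite_boolean_quadric_polytope_def)
    show "(\<Sum>a\<in>A. t a) = 1"
      by (simp add: sumA t_def)
    fix a assume a: "a \<in> A"
    then show "0 \<le> t a"
      using x0 x1 by (auto simp: A_def t_def)
    have "e a \<in> multiple_choice X {X}"
      using a by (auto simp: A_def e_def multiple_choice_def binary_vectors_def coord_space_def axis_def)
    moreover have "0 \<le> w a $ j \<and> w a $ j \<le> 1" for j
      using a x0 \<theta>01 z0 zx by (auto simp: A_def w_def divide_le_eq_1 less_le)
    ultimately show "p a \<in> ?C"
      unfolding p_def by (intro polytope_fibre[OF XY edges]) auto
  qed
  moreover have "(\<Sum>a\<in>A. t a *\<^sub>R p a) = (x, y, z)"
  proof -
    have "(\<Sum>a\<in>A. t a * e a $ k) = x $ k" for k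
      using x by (auto simp: sumA t_def e_def axis_def coord_space_def if_distrib cong: if_cong)
    moreover have "(\<Sum>a\<in>A. t a * restrict_vec Y (w a) $ j) = y $ j" for j
    proof (cases "j \<in> Y")
      case True
      have "(\<Sum>a\<in>A. t a * restrict_vec Y (w a) $ j) =
          (1 - (\<Sum>i\<in>X. x $ i)) * \<theta> j + (\<Sum>i\<in>X. if i \<in> N j then z $ {i, j} else x $ i * \<theta> j)"
        using True by (simp add: sumA t_def restrict_vec_def xw) (simp add: w_def)
      also have "(\<Sum>i\<in>X. if i \<in> N j then z $ {i, j} else x $ i * \<theta> j) =
          (\<Sum>i\<in>N j. z $ {i, j}) + (\<Sum>i\<in>X - N j. x $ i * \<theta> j)"
        by (subst sum.If_cases) (auto simp: N_def Int_commute Diff_eq intro!: arg_cong2[of _ _ _ _ "(+)"] sum.cong)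
      also have "(\<Sum>i\<in>X - N j. x $ i * \<theta> j) = ((\<Sum>i\<in>X. x $ i) - (\<Sum>i\<in>N j. x $ i)) * \<theta> j"
        by (subst sum_diff[symmetric]) (auto simp: N_def sum_distrib_right)
      \<comment> \<open>The outcome \<open>None\<close> and the non-neighbours of \<open>j\<close>
        together give \<open>\<theta> j\<close> the weight
        \<open>1 - (\<Sum>i\<in>N j. x $ i)\<close>, which is its denominator; what remains is
        \<open>y $ j\<close>.\<close>
      finally show ?thesis
        using \<theta>[OF True] by (simp add: algebra_simps)
    next
      case False
      then show ?thesis
        using y by (simp add: restrict_vec_def coord_space_def)
    qed
    moreover have "(\<Sum>a\<in>A. t a * edge_products X Y E (e a) (w a) $ d) = z $ d" for d
    proof (cases "d \<in> E")
      case True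
      then obtain i j where d: "i \<in> X" "j \<in> Y" "d = {i, j}"
        using edges by blast
      \<comment> \<open>Only the outcome selecting the endpoint \<open>i\<close> of the edge gives a
        nonzero product, so the sum collapses to a single joint mass.\<close>
      have "t (Some k) * edge_products X Y E (e (Some k)) (w (Some k)) $ d =
          (if k = i then x $ i * w (Some i) $ j else 0)" if "k \<in> X" for k
        using d True by (simp add: t_def e_def edge_products_edge[OF XY] axis_def)
      moreover have "edge_products X Y E (e None) (w None) $ d = 0"
        using d True by (simp add: e_def edge_products_edge[OF XY])
      ultimately have "(\<Sum>a\<in>A. t a * edge_products X Y E (e a) (w a) $ d) = x $ i * w (Some i) $ j"
        using d by (simp add: sumA)
      then show ?thesis
        using d True xw[of i j] by (simp add: N)
    next
      case False
      then show ?thesis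
        using z by (simp add: edge_products_def coord_space_def)
    qed
    ultimately show ?thesis
      by (simp add: prod_eq_iff vec_eq_iff fst_sum snd_sum p_def)
  qed
  ultimately show "(x, y, z) \<in> ?C"
    by simp
qed

theorem corollary3p6:
  fixes X Y :: "'v::finite set" and E :: "'v set set" and \<I> :: "'v set set"
    and H :: "((real ^ 'v) \<times> (real ^ 'v) \<times> (real ^ ('v set))) set"
  assumes "bipartite_graph X Y E"
    and "\<I> = {X}"
    and "H = relaxation X Y E \<I>"
  shows "H = bipartite_boolean_quadric_polytope X Y E \<I>"
  using relaxation_subset_polytope[OF assms(1)] polytope_subset_relaxation[of "{X}" X Y E] assms(2,3)
  by auto

end
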